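(* Every chordal graph $G$ is fully orientable.
   Context: All graphs are finite, without loops or multiple edges. An orientation of $G$ assigns a direction to each edge; it is acyclic if it contains no directed cycle. In an acyclic orientation $D$, an arc is called dependent if reversing it creates a directed cycle (equivalently, $u\to v$ is dependent iff there is a directed walk of length at least two from $u$ to $v$). $d(D)$ is the number of dependent arcs of $D$; $d_{\min}(G)$ and $d_{\max}(G)$ are the minimum and maximum of $d(D)$ over all acyclic orientations $D$ of $G$. $G$ is fully orientable if for every integer $d$ with $d_{\min}(G)\le d\le d_{\max}(G)$ there is an acyclic orientation $D$ of $G$ with $d(D)=d$. A graph is chordal if every cycle of length at least four has a chord (an edge joining two non-consecutive vertices of the cycle). *)

theory Defs
  imports "Graph_Theory.Pair_Digraph"
begin

text \<open>
  A finite simple graph is a \<^locale>\<open>pair_graph\<close>: an edge between \<open>u\<close> and \<open>v\<close> is represented by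
  the two arcs \<open>(u, v)\<close> and \<open>(v, u)\<close>. An orientation keeps exactly one of the two, and is given by
  its set of arcs.
\<close>

definition orientation :: "'a pair_pre_digraph \<Rightarrow> 'a rel \<Rightarrow> bool" where
  "orientation G D \<longleftrightarrow> D \<union> D\<inverse> = parcs G \<and> D \<inter> D\<inverse> = {}"

definition acyclic_orientations :: "'a pair_pre_digraph \<Rightarrow> 'a rel set" where
  "acyclic_orientations G = {D. orientation G D \<and> acyclic D}"

definition dependent_arcs :: "'a rel \<Rightarrow> 'a rel" where
  "dependent_arcs D = {(u, v) \<in> D. \<not> acyclic (insert (v, u) (D - {(u, v)}))}"

definition num_dependent :: "'a rel \<Rightarrow> nat" where
  "num_dependent D = card (dependent_arcs D)"

definition d_min :: "'a pair_pre_digraph \<Rightarrow> nat" where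
  "d_min G = Min (num_dependent ` acyclic_orientations G)"

definition d_max :: "'a pair_pre_digraph \<Rightarrow> nat" where
  "d_max G = Max (num_dependent ` acyclic_orientations G)"

definition fully_orientable :: "'a pair_pre_digraph \<Rightarrow> bool" where
  "fully_orientable G \<longleftrightarrow>
     (\<forall>d. d_min G \<le> d \<and> d \<le> d_max G \<longrightarrow> (\<exists>D \<in> acyclic_orientations G. num_dependent D = d))"

text \<open>
  A cycle is a list of arcs, so its vertices are the first components of these arcs. On a cycle of
  length at least four, two vertices are consecutive iff one of the two arcs between them lies on
  the cycle. (The cycles of length two of a symmetric digraph are excluded by the length bound.)
\<close>

definition chord :: "'a pair_pre_digraph \<Rightarrow> ('a \<times> 'a) awalk \<Rightarrow> 'a \<Rightarrow> 'a \<Rightarrow> bool" where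
  "chord G p u v \<longleftrightarrow> u \<in> fst ` set p \<and> v \<in> fst ` set p \<and> (u, v) \<in> parcs G \<and>
     (u, v) \<notin> set p \<and> (v, u) \<notin> set p"

definition chordal :: "'a pair_pre_digraph \<Rightarrow> bool" where
  "chordal G \<longleftrightarrow>
     (\<forall>p. pre_digraph.cycle (with_proj G) p \<and> length p \<ge> 4 \<longrightarrow> (\<exists>u v. chord G p u v))"

text \<open>The minimum and maximum above range over a finite nonempty set.\<close>

lemma finite_acyclic_orientations:
  assumes "pair_graph G"
  shows "finite (acyclic_orientations G)"
proof -
  interpret pair_graph G by fact
  have "acyclic_orientations G \<subseteq> Pow (parcs G)"
    by (auto simp: acyclic_orientations_def orientation_def)
  then show ?thesis
    using pair_finite_arcs by (meson finite_Pow_iff finite_subset)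
qed

lemma acyclic_orientations_nonempty:
  assumes "pair_graph G"
  shows "acyclic_orientations G \<noteq> {}"
proof -
  interpret pair_graph G by fact
  obtain f :: "'a \<Rightarrow> nat" where f: "inj_on f (pverts G)"
    using pair_finite_verts finite_imp_inj_to_nat_seg by blast
  define D where "D = {(u, v) \<in> parcs G. f u < f v}"
  have sym: "(v, u) \<in> parcs G" if "(u, v) \<in> parcs G" for u v
    using pair_sym_arcs that by (auto simp: symmetric_def dest: symD)
  have ne: "f u \<noteq> f v" if "(u, v) \<in> parcs G" for u v
    using that f pair_no_loops wellformed' by (fastforce dest: inj_onD)
  have "orientation G D"
    using sym ne by (auto simp: orientation_def D_def) (meson linorder_neqE_nat)
  moreover have "D \<subseteq> measure f"
    by (auto simp: D_def)
  then have "acyclic D"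
    by (meson acyclic_subset wf_acyclic wf_measure)
  ultimately show ?thesis
    by (auto simp: acyclic_orientations_def)
qed

end

theory Submission
  imports Defs
begin

text \<open>
  Let \<open>v\<close> be a vertex of \<open>G\<close> whose \<open>k\<close> neighbours form a clique. An acyclic orientation \<open>D\<close> orders
  the clique linearly and inserts \<open>v\<close> at some place. Every walk through \<open>v\<close> can be shortcut inside
  the clique, so compared with \<open>G - v\<close> the dependent arcs gained are all arcs at \<open>v\<close> except those
  joining it to its immediate predecessor and successor, and possibly the arc between these two.
  Hence \<open>d(D)\<close> is \<open>d(D - v) + k - 1\<close> or one less (just \<open>d(D - v)\<close> if \<open>k = 0\<close>), and the former value
  is attained over every acyclic orientation of \<open>G - v\<close>, by making \<open>v\<close> a sink. So if the values for
  \<open>G - v\<close> form an interval, then so do those for \<open>G\<close>.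

  A chordal graph that is not complete has such a vertex: choose a connected set \<open>X\<close> maximal subject
  to some vertex lying outside \<open>X \<union> N(X)\<close>. By maximality every vertex of \<open>N(X)\<close> is adjacent to
  every vertex outside \<open>X \<union> N(X)\<close>, and by chordality \<open>N(X)\<close> is a clique; so a simplicial vertex
  of the subgraph induced outside \<open>X \<union> N(X)\<close> is simplicial in the whole graph.
\<close>

subsection \<open>Simplicial vertices of chordal graphs\<close>

text \<open>A shortest walk works: a repeated vertex or an arc skipping ahead would shorten it.
  Backward arcs of \<open>T\<close> are not restricted; a symmetric \<open>T\<close> turns the bound
  into a two-sided one.\<close>

lemma induced_path_if_rtrancl:
  assumes "(a, b) \<in> T\<^sup>*"
  obtains f and n :: nat where "f 0 = a" "f n = b" "\<And>i. i < n \<Longrightarrow> (f i, f (Suc i)) \<in> T"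
    "inj_on f {..n}" "\<And>i j. \<lbrakk>i \<le> n; j \<le> n; (f i, f j) \<in> T\<rbrakk> \<Longrightarrow> j \<le> Suc i"
proof -
  define n where "n = (LEAST n. (a, b) \<in> T ^^ n)"
  have "(a, b) \<in> T ^^ n"
    unfolding n_def using assms by (metis LeastI rtrancl_imp_relpow)
  then obtain f where f: "f 0 = a" "f n = b" "\<And>i. i < n \<Longrightarrow> (f i, f (Suc i)) \<in> T"
    unfolding relpow_fun_conv by auto
  have least: "n \<le> m" if "(a, b) \<in> T ^^ m" for m
    unfolding n_def using that by (rule Least_le)
  have seg: "(f i, f j) \<in> T ^^ (j - i)" if "i \<le> j" "j \<le> n" for i j
    unfolding relpow_fun_conv using that f(3) by (intro exI[of _ "\<lambda>k. f (i + k)"]) auto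
  \<comment> \<open>Splicing an \<open>m\<close>-step walk between the first \<open>i\<close> and
    the last \<open>n - j\<close> steps cannot beat the minimal length. \<open>m = 0\<close> gives
    injectivity, \<open>m = 1\<close> the absence of skipping arcs.\<close>
  have jump: "j \<le> i + m" if "i \<le> n" "j \<le> n" "(f i, f j) \<in> T ^^ m" for i j m
  proof -
    have "(a, f i) \<in> T ^^ i" "(f j, b) \<in> T ^^ (n - j)"
      using seg[of 0 i] seg[of j n] that f by auto
    then have "(a, b) \<in> T ^^ (i + m + (n - j))"
      using that(3) by (auto simp: relpow_add)
    then show ?thesis using least that by fastforce
  qed
  have "inj_on f {..n}"
  proof (rule inj_onI)
    fix i j assume "i \<in> {..n}" "j \<in> {..n}" "f i = f j"
    then show "i = j" using jump[of i j 0] jump[of j i 0] by auto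
  qed
  moreover have "j \<le> Suc i" if "i \<le> n" "j \<le> n" "(f i, f j) \<in> T" for i j
    using jump[of i j 1] that by simp
  ultimately show ?thesis using that f by blast
qed

lemma cas_map_upt:
  "i \<le> n \<Longrightarrow> pre_digraph.cas (with_proj G) (f i) (map (\<lambda>k. (f k, f (Suc k))) [i..<n] @ p) w
    \<longleftrightarrow> pre_digraph.cas (with_proj G) (f n) p w"
proof (induction "n - i" arbitrary: i)
  case 0
  then show ?case by simp
next
  case (Suc m)
  then have "m = n - Suc i" "Suc i \<le> n" "i < n" by auto
  then show ?case using Suc.hyps(1)[of "Suc i"]
    by (simp add: upt_conv_Cons pre_digraph.cas.simps with_proj_def)
qed

text \<open>If \<open>a\<close> and \<open>b\<close> were not adjacent, a shortest path between them
  through \<open>X\<close>, closed up via \<open>r\<close>, would be a chordless cycle of length at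
  least four: \<open>r\<close> has no neighbour in \<open>X\<close>, and the path is
  induced.\<close>

lemma chordal_common_neighbours_adjacent:
  fixes G :: "'a pair_pre_digraph"
  assumes G: "pair_graph G" and ch: "chordal G"
    and X: "X \<inter> parcs G `` {r} = {}" "r \<notin> X"
    and a: "(a, x) \<in> parcs G" "x \<in> X" and b: "(b, y) \<in> parcs G" "y \<in> X"
    and xy: "(x, y) \<in> (parcs G \<inter> X \<times> X)\<^sup>*"
    and r: "(r, a) \<in> parcs G" "(r, b) \<in> parcs G" and ab: "a \<noteq> b"
  shows "(a, b) \<in> parcs G"
proof (rule ccontr)
  interpret pair_graph G by fact
  assume nab: "(a, b) \<notin> parcs G"
  have sym: "(v, u) \<in> parcs G" if "(u, v) \<in> parcs G" for u v
    using pair_sym_arcs that by (auto simp: symmetric_def dest: symD)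
  have irr: "(u, u) \<notin> parcs G" for u using pair_no_loops[of "(u, u)"] by auto
  define Y where "Y = insert a (insert b X)"
  define T where "T = parcs G \<inter> Y \<times> Y"
  have "(x, y) \<in> T\<^sup>*"
    using xy by (rule rtrancl_mono[THEN subsetD, rotated]) (auto simp: T_def Y_def)
  moreover have "(a, x) \<in> T" "(y, b) \<in> T" using a b sym by (auto simp: T_def Y_def)
  ultimately have "(a, b) \<in> T\<^sup>*" by (meson converse_rtrancl_into_rtrancl rtrancl.rtrancl_into_rtrancl)
  then obtain f n where f: "f 0 = a" "f n = b" "\<And>i. i < n \<Longrightarrow> (f i, f (Suc i)) \<in> T"
    and inj: "inj_on f {..n}"
    and ind: "\<And>i j. \<lbrakk>i \<le> n; j \<le> n; (f i, f j) \<in> T\<rbrakk> \<Longrightarrow> j \<le> Suc i"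
    by (rule induced_path_if_rtrancl) blast
  have n2: "2 \<le> n"
  proof (rule ccontr)
    assume "\<not> 2 \<le> n"
    then consider "n = 0" | "n = 1" by linarith
    then show False using f(1,2) f(3)[of 0] ab nab by cases (auto simp: T_def)
  qed
  have fY: "f i \<in> Y" if "i \<le> n" for i
    using that f(1,2) f(3)[of i] by (cases "i = n") (auto simp: T_def Y_def)
  have fX: "f i \<in> X" if "0 < i" "i < n" for i
    using fY[of i] that inj_onD[OF inj, of i 0] inj_onD[OF inj, of i n] f(1,2) by (auto simp: Y_def)
  have rY: "r \<notin> Y" using X r irr by (auto simp: Y_def)
  define p where "p = map (\<lambda>k. (f k, f (Suc k))) [0..<n] @ [(b, r), (r, a)]"
  have setp: "set p = (\<lambda>k. (f k, f (Suc k))) ` {..<n} \<union> {(b, r), (r, a)}"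
    by (auto simp: p_def)
  have vp: "fst ` set p = insert r (f ` {..n})"
  proof -
    have "{..n} = insert n {..<n}" by auto
    then show ?thesis using f(2) by (auto simp: setp image_image)
  qed
  have cas: "pre_digraph.cas (with_proj G) a p a"
    unfolding p_def using cas_map_upt[of 0 n G f "[(b, r), (r, a)]" a] f(1,2)
    by (simp add: pre_digraph.cas.simps with_proj_def)
  \<comment> \<open>A cycle needs distinct vertices after the initial one, which are the heads of
    its arcs; \<open>a\<close> is therefore counted once, at the end.\<close>
  have "map snd p = map f [1..<Suc n] @ [r, a]"
    by (simp add: p_def comp_def map_Suc_upt[symmetric] del: upt_Suc)
  moreover have "distinct (map f [1..<Suc n] @ [r, a])"
  proof -
    have "inj_on f {1..<Suc n}" using inj by (rule inj_on_subset) auto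
    moreover have "r \<notin> f ` {1..<Suc n}" using fY rY by auto
    moreover have "a \<notin> f ` {1..<Suc n}" using inj_onD[OF inj, of _ 0] f(1) by fastforce
    moreover have "r \<noteq> a" using rY by (auto simp: Y_def)
    ultimately show ?thesis by (auto simp: distinct_map simp del: upt_Suc)
  qed
  moreover have "pre_digraph.awalk_verts (with_proj G) a p = a # map snd p"
    using pre_digraph.awalk_verts_conv'[OF cas] n2 f(1)
    by (simp add: p_def with_proj_def hd_append hd_map del: upt_Suc)
  moreover have "set p \<subseteq> parcs G" using f(3) r sym by (auto simp: setp T_def)
  moreover have "a \<in> pverts G" using a(1) wellformed' by auto
  ultimately have "pre_digraph.cycle (with_proj G) p"
    using cas unfolding pre_digraph.cycle_def pre_digraph.awalk_def
    by (intro exI[of _ a]) (auto simp: p_def)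
  moreover have "length p \<ge> 4" using n2 by (simp add: p_def)
  ultimately obtain u v where c: "chord G p u v" using ch unfolding chordal_def by blast
  \<comment> \<open>The only neighbours of \<open>r\<close> on the cycle are \<open>a\<close> and
    \<open>b\<close>, and both edges to them lie on \<open>p\<close>.\<close>
  have no_r: False if "chord G p r w" for w
  proof -
    have w: "w \<in> fst ` set p" "(r, w) \<in> parcs G" "(r, w) \<notin> set p" "(w, r) \<notin> set p"
      using that by (auto simp: chord_def)
    then obtain i where i: "i \<le> n" "w = f i" using irr by (auto simp: vp)
    have "w \<noteq> a" "w \<noteq> b" using w by (auto simp: setp)
    then have "w \<in> X" using fY[OF i(1)] i by (auto simp: Y_def)
    then show False using w X by auto
  qed
  have chsym: "chord G p v u" using c sym by (auto simp: chord_def)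
  have "u \<noteq> r" "v \<noteq> r" using no_r c chsym by auto
  then obtain i j where ij: "i \<le> n" "j \<le> n" "u = f i" "v = f j"
    using c by (auto simp: chord_def vp)
  \<comment> \<open>Having the chord in both directions, \<open>ind\<close> bounds the index
    difference by one, so the chord would be an edge of the path.\<close>
  have e: "(u, v) \<in> T" "(v, u) \<in> T" using c chsym fY ij by (auto simp: chord_def T_def)
  then have "j \<le> Suc i" "i \<le> Suc j" using ind ij by auto
  then consider "i = j" | "j = Suc i" | "i = Suc j" by linarith
  then show False
  proof cases
    case 1
    then show ?thesis using e ij irr by (auto simp: T_def)
  next
    case 2
    then have "(u, v) \<in> set p" using ij by (auto simp: setp)
    then show ?thesis using c by (auto simp: chord_def)
  next
    case 3
    then have "(v, u) \<in> set p" using ij by (auto simp: setp)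
    then show ?thesis using c by (auto simp: chord_def)
  qed
qed

text \<open>Induced subgraphs are represented by their vertex set \<open>R\<close>, so the induction
  keeps a single graph \<open>G\<close> and its chordality.\<close>

lemma chordal_ex_simplicial:
  fixes G :: "'a pair_pre_digraph"
  assumes G: "pair_graph G" and ch: "chordal G"
    and R: "finite R" "R \<noteq> {}"
  shows "\<exists>v\<in>R. \<forall>a\<in>R. \<forall>b\<in>R. (v, a) \<in> parcs G \<and> (v, b) \<in> parcs G \<and> a \<noteq> b \<longrightarrow> (a, b) \<in> parcs G"
  using R
proof (induction R rule: finite_psubset_induct)
  case (psubset R)
  interpret pair_graph G by fact
  have sym: "(v, u) \<in> parcs G" if "(u, v) \<in> parcs G" for u v
    using pair_sym_arcs that by (auto simp: symmetric_def dest: symD)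
  define N where "N = (\<lambda>X. parcs G `` X \<inter> R - X)"
  show ?case
  proof (cases "\<exists>s\<in>R. R - {s} - N {s} \<noteq> {}")
    \<comment> \<open>Here any two distinct vertices of \<open>R\<close> are adjacent, so every
      vertex is simplicial.\<close>
    case False
    then show ?thesis using psubset.prems by (fastforce simp: N_def)
  next
    case True
    then obtain s where s: "s \<in> R" "R - {s} - N {s} \<noteq> {}" by auto
    \<comment> \<open>Connectedness of \<open>X\<close> is reachability from the fixed vertex
      \<open>s\<close> inside \<open>X\<close>; maximality will be by cardinality.\<close>
    define P where "P = (\<lambda>X. s \<in> X \<and> X \<subseteq> R \<and> R - X - N X \<noteq> {} \<and> (\<forall>x\<in>X. (s, x) \<in> (parcs G \<inter> X \<times> X)\<^sup>*))"
    have "P {s}" using s by (auto simp: P_def)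
    moreover have "card X \<le> card R" if "P X" for X
      using that psubset.hyps by (auto simp: P_def card_mono)
    ultimately obtain X where X: "P X" and max: "\<And>X'. P X' \<Longrightarrow> card X' \<le> card X"
      using ex_has_greatest_nat[of P "{s}" card "Suc (card R)"] by (metis less_Suc_eq_le)
    define S where "S = N X"
    define Q where "Q = R - X - S"
    have Q: "Q \<noteq> {}" "Q \<subset> R" using X by (auto simp: P_def Q_def S_def)
    have finX: "finite X" using X psubset.hyps by (auto simp: P_def intro: finite_subset)
    have conn: "(x, y) \<in> (parcs G \<inter> X \<times> X)\<^sup>*" if "x \<in> X" "y \<in> X" for x y
    proof -
      have "sym (parcs G \<inter> X \<times> X)" using sym by (auto intro: symI)
      then have "sym ((parcs G \<inter> X \<times> X)\<^sup>*)" by (rule sym_rtrancl)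
      moreover have "(s, x) \<in> (parcs G \<inter> X \<times> X)\<^sup>*" "(s, y) \<in> (parcs G \<inter> X \<times> X)\<^sup>*"
        using X that by (simp_all add: P_def)
      ultimately show ?thesis by (metis rtrancl_trans symD)
    qed
    \<comment> \<open>Otherwise \<open>z\<close> could be added to \<open>X\<close>: it is attached
      to \<open>X\<close>, and \<open>q\<close> would still lie outside the enlarged set and its
      neighbourhood.\<close>
    have SQ: "(q, z) \<in> parcs G" if zq: "z \<in> S" "q \<in> Q" for z q
    proof (rule ccontr)
      assume nq: "(q, z) \<notin> parcs G"
      obtain x where x: "x \<in> X" "(x, z) \<in> parcs G" and z: "z \<in> R" "z \<notin> X"
        using zq by (auto simp: S_def N_def)
      let ?Z = "insert z X"
      have mono: "(parcs G \<inter> X \<times> X)\<^sup>* \<subseteq> (parcs G \<inter> ?Z \<times> ?Z)\<^sup>*" by (rule rtrancl_mono) auto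
      have "(s, w) \<in> (parcs G \<inter> ?Z \<times> ?Z)\<^sup>*" if "w \<in> ?Z" for w
      proof (cases "w = z")
        case True
        have "(s, x) \<in> (parcs G \<inter> ?Z \<times> ?Z)\<^sup>*" using mono X x by (auto simp: P_def)
        moreover have "(x, z) \<in> parcs G \<inter> ?Z \<times> ?Z" using x by auto
        ultimately show ?thesis using True by (meson rtrancl.rtrancl_into_rtrancl)
      next
        case False
        then show ?thesis using that mono X by (auto simp: P_def)
      qed
      moreover have "q \<in> R - ?Z - N ?Z"
        using zq nq sym by (auto simp: Q_def S_def N_def)
      ultimately have "P ?Z" using X z by (auto simp: P_def)
      then show False using max[of ?Z] z finX by simp
    qed
    \<comment> \<open>Any \<open>q\<close> in \<open>Q\<close> can serve as the vertex
      \<open>r\<close> of the previous lemma: it sees all of \<open>S\<close> and nothing of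
      \<open>X\<close>.\<close>
    have SS: "(a, b) \<in> parcs G" if ab: "a \<in> S" "b \<in> S" "a \<noteq> b" for a b
    proof -
      obtain q where q: "q \<in> Q" using Q by auto
      have "X \<inter> parcs G `` {q} = {}" "q \<notin> X"
        using q sym by (auto simp: Q_def S_def N_def)
      moreover obtain x where "x \<in> X" "(a, x) \<in> parcs G" using ab sym by (auto simp: S_def N_def)
      moreover obtain y where "y \<in> X" "(b, y) \<in> parcs G" using ab sym by (auto simp: S_def N_def)
      ultimately show ?thesis
        using chordal_common_neighbours_adjacent[OF G ch] conn SQ[OF _ q] ab by metis
    qed
    obtain v where v: "v \<in> Q"
      "\<And>a b. \<lbrakk>a \<in> Q; b \<in> Q; (v, a) \<in> parcs G; (v, b) \<in> parcs G; a \<noteq> b\<rbrakk> \<Longrightarrow> (a, b) \<in> parcs G"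
      using psubset.IH[OF Q(2,1)] by blast
    have vN: "a \<in> Q \<union> S" if "a \<in> R" "(v, a) \<in> parcs G" for a
      using that v(1) sym by (auto simp: Q_def S_def N_def)
    have "(a, b) \<in> parcs G"
      if "a \<in> R" "b \<in> R" "(v, a) \<in> parcs G" "(v, b) \<in> parcs G" "a \<noteq> b" for a b
      using vN[of a] vN[of b] that v(2) SS SQ sym by blast
    then show ?thesis using v(1) Q(2) by blast
  qed
qed

subsection \<open>Dependent arcs and deletion of a simplicial vertex\<close>

text \<open>Working with the bare edge relation makes vertex deletion an intersection. Acyclicity
  already rules out opposite arcs.\<close>

definition acyclic_orients :: "'a rel \<Rightarrow> 'a rel set" where
  "acyclic_orients E = {D. D \<union> D\<inverse> = E \<and> acyclic D}"

lemma acyclic_imp_asymD: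
  assumes "acyclic D" "(x, y) \<in> D"
  shows "(y, x) \<notin> D"
  using assms by (meson acyclic_def r_into_trancl trancl_into_trancl)

lemma acyclic_orientations_eq_acyclic_orients:
  "acyclic_orientations G = acyclic_orients (parcs G)"
proof -
  have "D \<inter> D\<inverse> = {}" if "acyclic D" for D :: "'a rel"
    using acyclic_imp_asymD[OF that] by auto
  then show ?thesis
    unfolding acyclic_orientations_def orientation_def acyclic_orients_def by auto
qed

text \<open>Reversing an arc closes a cycle iff some walk joins its ends without it. In an acyclic
  \<open>D\<close>, a walk of length at least two between the ends avoids the arc anyway.\<close>

lemma dependent_arcs_eq:
  assumes "acyclic D"
  shows "dependent_arcs D = D \<inter> (D O D\<^sup>+)"
proof -
  have "\<not> acyclic (insert (v, u) (D - {(u, v)})) \<longleftrightarrow> (u, v) \<in> D O D\<^sup>+" if uv: "(u, v) \<in> D" for u v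
  proof -
    let ?r = "D - {(u, v)}"
    have D: "D = insert (u, v) ?r" using uv by auto
    have acr: "acyclic ?r" using assms by (rule acyclic_subset) auto
    have nuv: "u \<noteq> v" using assms uv by (auto simp: acyclic_def)
    have "(u, v) \<in> ?r\<^sup>* \<longleftrightarrow> (u, v) \<in> D O D\<^sup>+"
    proof
      assume "(u, v) \<in> ?r\<^sup>*"
      then obtain w where w: "(u, w) \<in> ?r" "(w, v) \<in> ?r\<^sup>*"
        using nuv by (meson converse_rtranclE)
      then have "(w, v) \<in> D\<^sup>*" using rtrancl_mono[of ?r D] by blast
      then show "(u, v) \<in> D O D\<^sup>+" using w(1) by (auto simp: rtrancl_eq_or_trancl)
    next
      assume "(u, v) \<in> D O D\<^sup>+"
      then obtain w where w: "(u, w) \<in> D" "(w, v) \<in> D\<^sup>+" by auto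
      have "w \<noteq> v" using w(2) assms by (auto simp: acyclic_def)
      then have uw: "(u, w) \<in> ?r" using w(1) by auto
      \<comment> \<open>Since \<open>w\<close> cannot return to \<open>u\<close>, the walk from
        \<open>w\<close> to \<open>v\<close> never uses the arc \<open>(u, v)\<close>.\<close>
      have "(w, u) \<notin> ?r\<^sup>*"
        using uw acr by (meson acyclic_def rtrancl_into_trancl2)
      then have "(w, v) \<in> ?r\<^sup>+"
        using w(2) trancl_insert[of u v ?r] D by auto
      then show "(u, v) \<in> ?r\<^sup>*" using uw by (meson converse_rtrancl_into_rtrancl trancl_into_rtrancl)
    qed
    then show ?thesis using acr by (simp add: acyclic_insert)
  qed
  then show ?thesis unfolding dependent_arcs_def by auto
qed

lemma dependent_arcs_converse:
  assumes "acyclic D"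
  shows "dependent_arcs (D\<inverse>) = (dependent_arcs D)\<inverse>"
proof -
  have "D\<^sup>+ O D = D O D\<^sup>+"
    by (metis r_comp_rtrancl_eq trancl_unfold_left trancl_unfold_right O_assoc)
  then show ?thesis
    using assms by (auto simp: dependent_arcs_eq trancl_converse simp flip: converse_relcomp)
qed

text \<open>\<open>D\<close> orders the in-neighbours of \<open>v\<close> linearly, and only the arc
  from the last of them is not dependent. Truncated subtraction covers the empty case.\<close>

lemma card_dependent_arcs_into:
  assumes acyc: "acyclic D" and fin: "finite A" and A: "A = {u. (u, v) \<in> D}" and tot: "total_on A D"
  shows "card (dependent_arcs D \<inter> UNIV \<times> {v}) = card A - 1"
proof (cases "A = {}")
  case True
  then have "dependent_arcs D \<inter> UNIV \<times> {v} = {}"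
    using A by (auto simp: dependent_arcs_def)
  then show ?thesis using True by simp
next
  case False
  have "acyclic (D \<inter> A \<times> A)" using acyc by (rule acyclic_subset) auto
  then have "wf ((D \<inter> A \<times> A)\<inverse>)"
    using fin by (intro finite_acyclic_wf_converse) auto
  then obtain m where m: "m \<in> A" and m_min: "\<And>a. (a, m) \<in> (D \<inter> A \<times> A)\<inverse> \<Longrightarrow> a \<notin> A"
    using False by (rule wfE_min') iprover
  have sink: "(m, a) \<notin> D" if "a \<in> A" for a
    using m_min[of a] that m by auto
  \<comment> \<open>The last vertex \<open>z\<close> before \<open>v\<close> on a longer walk from
    \<open>u\<close> is again in \<open>A\<close> and comes after \<open>u\<close>, so
    \<open>u\<close> is not the sink \<open>m\<close>. Conversely, every other \<open>u\<close>
    reaches \<open>v\<close> through \<open>m\<close>.\<close>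
  have "dependent_arcs D \<inter> UNIV \<times> {v} = (A - {m}) \<times> {v}"
  proof (intro equalityI subsetI)
    fix e assume "e \<in> dependent_arcs D \<inter> UNIV \<times> {v}"
    then obtain u where e: "e = (u, v)" and u: "(u, v) \<in> D" "(u, v) \<in> D O D\<^sup>+"
      using acyc by (cases e) (auto simp: dependent_arcs_eq)
    then obtain z where z: "(u, z) \<in> D\<^sup>+" "(z, v) \<in> D"
      by (auto elim!: relcompE dest!: tranclD2 intro: rtrancl_into_trancl2)
    have "z \<in> A" "u \<in> A" using z u A by auto
    moreover have "z \<noteq> u" "(z, u) \<notin> D"
      using acyc z(1) by (auto simp: acyclic_def) (meson trancl.trancl_into_trancl)
    ultimately have "(u, z) \<in> D" using tot by (auto simp: total_on_def)
    then show "e \<in> (A - {m}) \<times> {v}" using e sink \<open>z \<in> A\<close> \<open>u \<in> A\<close> by auto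
  next
    fix e assume "e \<in> (A - {m}) \<times> {v}"
    then obtain u where e: "e = (u, v)" "u \<in> A" "u \<noteq> m" by auto
    then have "(u, m) \<in> D" using m sink tot by (auto simp: total_on_def)
    then show "e \<in> dependent_arcs D \<inter> UNIV \<times> {v}"
      using e m A acyc by (auto simp: dependent_arcs_eq)
  qed
  then show ?thesis using m fin by (simp add: card_cartesian_product)
qed

lemma card_dependent_arcs_from:
  assumes acyc: "acyclic D" and fin: "finite B" and B: "B = {w. (v, w) \<in> D}" and tot: "total_on B D"
  shows "card (dependent_arcs D \<inter> {v} \<times> UNIV) = card B - 1"
proof -
  have "card (dependent_arcs (D\<inverse>) \<inter> UNIV \<times> {v}) = card B - 1"
    using assms by (intro card_dependent_arcs_into) (auto simp: total_on_def)
  moreover have "dependent_arcs (D\<inverse>) \<inter> UNIV \<times> {v} = (dependent_arcs D \<inter> {v} \<times> UNIV)\<inverse>"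
    using acyc by (auto simp: dependent_arcs_converse)
  ultimately show ?thesis by simp
qed

text \<open>A passage from \<open>x\<close> through \<open>v\<close> to \<open>z\<close> is replaced
  by the arc from \<open>x\<close> to \<open>z\<close>, which exists because neighbours of
  \<open>v\<close> are adjacent and is so directed by acyclicity.\<close>

lemma trancl_Diff_vertex:
  assumes acyc: "acyclic D" and tot: "total_on ((D \<union> D\<inverse>) `` {v}) D"
    and D': "D' = D \<inter> (- {v}) \<times> (- {v})"
    and uw: "(u, w) \<in> D\<^sup>+" "u \<noteq> v" "w \<noteq> v"
  shows "(u, w) \<in> D'\<^sup>+"
proof -
  \<comment> \<open>For a walk that has just arrived at \<open>v\<close>, the invariant remembers
    the predecessor \<open>x\<close> from which the shortcut will start.\<close>
  have "(w \<noteq> v \<longrightarrow> (u, w) \<in> D'\<^sup>+) \<and> (w = v \<longrightarrow> (\<exists>x. x \<noteq> v \<and> (x, v) \<in> D \<and> (u, x) \<in> D'\<^sup>*))"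
    using uw(1)
  proof induction
    case (base y)
    then show ?case using uw(2) D' by auto
  next
    case (step y z)
    have "y \<noteq> z" using step.hyps(2) acyc by (auto simp: acyclic_def)
    show ?case
    proof (cases "y = v")
      case True
      then obtain x where x: "x \<noteq> v" "(x, v) \<in> D" "(u, x) \<in> D'\<^sup>*" using step.IH by auto
      have "(x, z) \<in> D\<^sup>+" using x(2) step.hyps(2) True by auto
      then have "x \<noteq> z" "(z, x) \<notin> D"
        using acyc by (auto simp: acyclic_def) (meson trancl.trancl_into_trancl)
      then have "(x, z) \<in> D"
        using tot x(2) step.hyps(2) True by (auto simp: total_on_def)
      then have "(x, z) \<in> D'" using x(1) True \<open>y \<noteq> z\<close> D' by auto
      then show ?thesis using x(3) True \<open>y \<noteq> z\<close> by (auto intro: rtrancl_into_trancl1)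
    next
      case False
      then have uy: "(u, y) \<in> D'\<^sup>+" using step.IH by simp
      show ?thesis
      proof (cases "z = v")
        case True
        then show ?thesis using uy step.hyps(2) False by auto
      next
        case z: False
        then have "(y, z) \<in> D'" using step.hyps(2) False D' by auto
        then show ?thesis using uy z by auto
      qed
    qed
  qed
  then show ?thesis using uw(3) by simp
qed

text \<open>Dependent arcs are counted by whether they enter, leave or avoid \<open>v\<close>. The
  term \<open>e\<close> counts arcs that are dependent only because of a detour through
  \<open>v\<close>; such an arc runs from \<open>A\<close> to \<open>B\<close>, and there is at most
  one.\<close>

lemma num_dependent_Diff_simplicial:
  assumes finD: "finite D" and acyc: "acyclic D"
    and tot: "total_on ((D \<union> D\<inverse>) `` {v}) D"
    and D': "D' = D \<inter> (- {v}) \<times> (- {v})"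
    and A: "A = {u. (u, v) \<in> D}" and B: "B = {w. (v, w) \<in> D}"
  obtains e where "e \<le> (1::nat)" "A = {} \<or> B = {} \<Longrightarrow> e = 0"
    "num_dependent D = num_dependent D' + (card A - 1) + (card B - 1) + e"
proof -
  have AB: "(D \<union> D\<inverse>) `` {v} = A \<union> B" using A B by auto
  have finA: "finite A"
    by (rule finite_subset[of _ "fst ` D"]) (use A finD in force)+
  have finB: "finite B"
    by (rule finite_subset[of _ "snd ` D"]) (use B finD in force)+
  have acD': "acyclic D'" using acyc by (rule acyclic_subset) (use D' in auto)
  have fdep: "finite (dependent_arcs D)" "finite (dependent_arcs D')"
    using finD D' by (auto simp: dependent_arcs_def intro: finite_subset[of _ D])
  have no_back: "x \<noteq> y" "(y, x) \<notin> D" if "(x, y) \<in> D\<^sup>+" for x y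
    using that acyc by (auto simp: acyclic_def) (meson trancl.trancl_into_trancl)
  have totD: "(x, y) \<in> D" if "(x, y) \<in> D\<^sup>+" "x \<in> A \<union> B" "y \<in> A \<union> B" for x y
    using tot that no_back[OF that(1)] unfolding AB total_on_def by blast
  have vAB: "v \<notin> A" "v \<notin> B" using acyc A B by (auto simp: acyclic_def)
  have AxB: "(x, y) \<in> D'" if "x \<in> A" "y \<in> B" for x y
  proof -
    have "(x, v) \<in> D" "(v, y) \<in> D" using that A B by auto
    then have "(x, y) \<in> D\<^sup>+" by auto
    then show ?thesis using totD that vAB D' by auto
  qed
  define X where "X = A \<times> B - dependent_arcs D'"
  have mid: "dependent_arcs D \<inter> (- {v}) \<times> (- {v}) = dependent_arcs D' \<union> X"
  proof (intro equalityI subsetI)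
    fix p assume "p \<in> dependent_arcs D \<inter> (- {v}) \<times> (- {v})"
    then obtain u w y where p: "p = (u, w)" "u \<noteq> v" "w \<noteq> v" "(u, w) \<in> D" "(u, y) \<in> D" "(y, w) \<in> D\<^sup>+"
      using acyc by (cases p) (auto simp: dependent_arcs_eq)
    have uwD': "(u, w) \<in> D'" using p D' by auto
    show "p \<in> dependent_arcs D' \<union> X"
    proof (cases "y = v")
      case False
      then have "(y, w) \<in> D'\<^sup>+" using trancl_Diff_vertex[OF acyc tot D'] p by auto
      moreover have "(u, y) \<in> D'" using False p D' by auto
      ultimately show ?thesis using p(1) uwD' acD' by (auto simp: dependent_arcs_eq)
    next
      case True
      then have uA: "u \<in> A" using p A by auto
      show ?thesis
      proof (cases "w \<in> B")
        case True
        then show ?thesis using uA p(1) X_def by auto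
      next
        \<comment> \<open>The walk leaves \<open>v\<close> through some \<open>z\<close> in
          \<open>B\<close>, and the arc from \<open>u\<close> to \<open>z\<close> bypasses
          \<open>v\<close>; thus the arc was dependent before.\<close>
        case False
        then obtain z where z: "z \<in> B" "(z, w) \<in> D\<^sup>+"
          using p(6) \<open>y = v\<close> B by (metis converse_tranclE mem_Collect_eq)
        then have "(z, w) \<in> D'\<^sup>+"
          using trancl_Diff_vertex[OF acyc tot D'] p vAB by metis
        then show ?thesis using AxB[OF uA z(1)] p(1) uwD' acD' by (auto simp: dependent_arcs_eq)
      qed
    qed
  next
    fix p assume "p \<in> dependent_arcs D' \<union> X"
    then consider "p \<in> dependent_arcs D'" | "p \<in> A \<times> B" using X_def by auto
    then show "p \<in> dependent_arcs D \<inter> (- {v}) \<times> (- {v})"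
    proof cases
      case 1
      have "D' \<subseteq> D" using D' by auto
      then have "D'\<^sup>+ \<subseteq> D\<^sup>+" by (simp add: trancl_mono_subset)
      then show ?thesis using 1 acyc acD' D' by (auto simp: dependent_arcs_eq)
    next
      case 2
      then obtain u w where p: "p = (u, w)" "u \<in> A" "w \<in> B" by auto
      then have "(u, w) \<in> D'" "(u, v) \<in> D" "(v, w) \<in> D" using AxB A B by auto
      then show ?thesis using p acyc D' by (auto simp: dependent_arcs_eq)
    qed
  qed
  have "p = q" if "p \<in> X" "q \<in> X" for p q
  proof -
    have max: "u = u'" if h: "(u, w) \<in> X" "(u', w') \<in> X" for u w u' w'
    proof (rule ccontr)
      assume "u \<noteq> u'"
      \<comment> \<open>If \<open>x\<close> precedes another \<open>y\<close> in \<open>A\<close>,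
        the walk from \<open>x\<close> via \<open>y\<close> to \<open>z\<close> makes the arc from
        \<open>x\<close> to \<open>z\<close> dependent in \<open>D'\<close> already. So tails of
        arcs in \<open>X\<close> coincide; heads are treated dually.\<close>
      have *: False if "(x, y) \<in> D" "(x, z) \<in> X" "y \<in> A" for x y z
      proof -
        have "x \<in> A" "z \<in> B" using that X_def by auto
        then have "(x, y) \<in> D'" "(y, z) \<in> D'" "(x, z) \<in> D'" using that AxB vAB D' by auto
        then show False using that(2) X_def acD' by (auto simp: dependent_arcs_eq)
      qed
      have "u \<in> A" "u' \<in> A" using h X_def by auto
      then have "(u, u') \<in> D \<or> (u', u) \<in> D"
        using tot \<open>u \<noteq> u'\<close> unfolding AB total_on_def by blast
      then show False using * h \<open>u \<in> A\<close> \<open>u' \<in> A\<close> by blast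
    qed
    have min: "w = w'" if h: "(u, w) \<in> X" "(u', w') \<in> X" for u w u' w'
    proof (rule ccontr)
      assume "w \<noteq> w'"
      have *: False if "(y, z) \<in> D" "(x, z) \<in> X" "y \<in> B" for x y z
      proof -
        have "x \<in> A" "z \<in> B" using that X_def by auto
        then have "(x, y) \<in> D'" "(y, z) \<in> D'" "(x, z) \<in> D'" using that AxB vAB D' by auto
        then show False using that(2) X_def acD' by (auto simp: dependent_arcs_eq)
      qed
      have "w \<in> B" "w' \<in> B" using h X_def by auto
      then have "(w, w') \<in> D \<or> (w', w) \<in> D"
        using tot \<open>w \<noteq> w'\<close> unfolding AB total_on_def by blast
      then show False using * h \<open>w \<in> B\<close> \<open>w' \<in> B\<close> by blast
    qed
    show ?thesis using that max min by (metis surj_pair)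
  qed
  moreover have finX: "finite X" using finA finB X_def by auto
  ultimately have X1: "card X \<le> 1" by (simp add: card_le_Suc0_iff_eq)
  have X0: "card X = 0" if "A = {} \<or> B = {}" using that X_def by auto
  let ?I = "dependent_arcs D \<inter> UNIV \<times> {v}" and ?O = "dependent_arcs D \<inter> {v} \<times> UNIV"
  let ?M = "dependent_arcs D \<inter> (- {v}) \<times> (- {v})"
  have split: "dependent_arcs D = ?M \<union> ?I \<union> ?O" by auto
  have "(v, v) \<notin> D" using acyc by (auto simp: acyclic_def)
  then have IO: "?I \<inter> ?O = {}" by (auto simp: dependent_arcs_def)
  have "num_dependent D = card (?M \<union> ?I \<union> ?O)" unfolding num_dependent_def using split by simp
  also have "\<dots> = card (?M \<union> ?I) + card ?O"
    by (rule card_Un_disjoint) (use fdep IO in auto)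
  also have "card (?M \<union> ?I) = card ?M + card ?I"
    by (rule card_Un_disjoint) (use fdep in auto)
  also have "card ?M = num_dependent D' + card X"
    unfolding mid num_dependent_def by (rule card_Un_disjoint) (use fdep finX X_def in auto)
  also have "card ?I = card A - 1"
    using acyc finA A by (rule card_dependent_arcs_into) (use tot AB in \<open>auto simp: total_on_def\<close>)
  also have "card ?O = card B - 1"
    using acyc finB B by (rule card_dependent_arcs_from) (use tot AB in \<open>auto simp: total_on_def\<close>)
  finally show ?thesis using that[of "card X"] X1 X0 by simp
qed

section \<open>Restriction and extension of acyclic orientations\<close>

lemma acyclic_orients_Diff_vertex:
  assumes "D \<in> acyclic_orients E"
  shows "D \<inter> (- {v}) \<times> (- {v}) \<in> acyclic_orients (E \<inter> (- {v}) \<times> (- {v}))"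
proof -
  have "acyclic (D \<inter> (- {v}) \<times> (- {v}))"
    using assms by (auto simp: acyclic_orients_def intro: acyclic_subset)
  then show ?thesis using assms by (auto simp: acyclic_orients_def)
qed

lemma total_on_neighbours:
  assumes D: "D \<in> acyclic_orients E"
    and clique: "total_on (E `` {v}) E"
  shows "total_on ((D \<union> D\<inverse>) `` {v}) D"
proof -
  have E: "E = D \<union> D\<inverse>" using D by (simp add: acyclic_orients_def)
  show ?thesis using clique unfolding E by (auto simp: total_on_def)
qed

text \<open>With \<open>k\<close> neighbours and both \<open>A\<close> and \<open>B\<close>
  nonempty, the gain is \<open>k - 2 + e\<close>; if one of them is empty, then \<open>e = 0\<close>
  and the gain is the truncated \<open>k - 1\<close>.\<close>

lemma num_dependent_Diff_simplicial_bounds: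
  assumes D: "D \<in> acyclic_orients E" and finE: "finite E"
    and clique: "total_on (E `` {v}) E"
    and D': "D' = D \<inter> (- {v}) \<times> (- {v})"
  shows "num_dependent D \<le> num_dependent D' + (card (E `` {v}) - 1)"
    and "num_dependent D' + (card (E `` {v}) - 1) \<le> Suc (num_dependent D)"
proof -
  have E: "D \<union> D\<inverse> = E" and acyc: "acyclic D" using D by (auto simp: acyclic_orients_def)
  have finD: "finite D" using finE E by (metis finite_Un)
  define A B where "A = {u. (u, v) \<in> D}" and "B = {w. (v, w) \<in> D}"
  obtain e where e: "e \<le> (1::nat)" "A = {} \<or> B = {} \<Longrightarrow> e = 0"
    "num_dependent D = num_dependent D' + (card A - 1) + (card B - 1) + e"
    using num_dependent_Diff_simplicial[OF finD acyc total_on_neighbours[OF D clique] D' A_def B_def]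
    by metis
  have "finite A"
    by (rule finite_subset[of _ "fst ` D"]) (use A_def finD in force)+
  moreover have "finite B"
    by (rule finite_subset[of _ "snd ` D"]) (use B_def finD in force)+
  moreover have "A \<inter> B = {}"
    using acyclic_imp_asymD[OF acyc] by (auto simp: A_def B_def)
  moreover have "E `` {v} = A \<union> B" using E by (auto simp: A_def B_def)
  ultimately have k: "card (E `` {v}) = card A + card B"
    and "A = {} \<longleftrightarrow> card A = 0" "B = {} \<longleftrightarrow> card B = 0"
    by (simp_all add: card_Un_disjoint)
  then show "num_dependent D \<le> num_dependent D' + (card (E `` {v}) - 1)"
    and "num_dependent D' + (card (E `` {v}) - 1) \<le> Suc (num_dependent D)"
    using e by (cases "card A = 0"; cases "card B = 0"; simp)+
qed

lemma ex_extension_simplicial_sink: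
  assumes D': "D' \<in> acyclic_orients (E \<inter> (- {v}) \<times> (- {v}))"
    and finE: "finite E" and symE: "sym E" and irr: "(v, v) \<notin> E"
    and clique: "total_on (E `` {v}) E"
  shows "\<exists>D \<in> acyclic_orients E. num_dependent D = num_dependent D' + (card (E `` {v}) - 1)"
proof -
  have E': "D' \<union> D'\<inverse> = E \<inter> (- {v}) \<times> (- {v})" and acD': "acyclic D'"
    using D' by (auto simp: acyclic_orients_def)
  then have D'v: "x \<noteq> v" "y \<noteq> v" if "(x, y) \<in> D'" for x y using that by auto
  define D where "D = D' \<union> (E `` {v}) \<times> {v}"
  have vout: "(v, y) \<notin> D" for y using D'v irr by (auto simp: D_def)
  \<comment> \<open>Walks may end in the sink \<open>v\<close> but never leave it, so a cycle of
    \<open>D\<close> would lie in \<open>D'\<close>.\<close>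
  have "(y = v \<and> x \<noteq> v) \<or> (y \<noteq> v \<and> (x, y) \<in> D'\<^sup>+)" if "(x, y) \<in> D\<^sup>+" for x y
    using that
  proof induction
    case (base y)
    then show ?case using D'v irr by (auto simp: D_def)
  next
    case (step y z)
    then have "y \<noteq> v" using vout by auto
    then have xy: "(x, y) \<in> D'\<^sup>+" using step.IH by auto
    then have "x \<noteq> v" using tranclD[OF xy] D'v by metis
    then show ?case using step.hyps(2) xy D'v by (auto simp: D_def intro: trancl_into_trancl)
  qed
  then have acyc: "acyclic D" using acD' by (auto simp: acyclic_def)
  have DE: "D \<union> D\<inverse> = E"
  proof (intro equalityI subsetI)
    fix p assume "p \<in> D \<union> D\<inverse>"
    then show "p \<in> E" using E' symE by (auto simp: D_def dest: symD)
  next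
    fix p assume p: "p \<in> E"
    obtain x y where xy: "p = (x, y)" by (cases p)
    show "p \<in> D \<union> D\<inverse>"
    proof (cases "x = v \<or> y = v")
      case True
      then show ?thesis using p xy symE by (auto simp: D_def dest: symD)
    next
      case False
      then have "p \<in> D' \<union> D'\<inverse>" unfolding E' using p xy by simp
      then show ?thesis by (auto simp: D_def)
    qed
  qed
  have DAO: "D \<in> acyclic_orients E" using DE acyc by (simp add: acyclic_orients_def)
  have finD: "finite D" using finE DE by (metis finite_Un)
  have res: "D' = D \<inter> (- {v}) \<times> (- {v})" using D'v by (auto simp: D_def)
  have A: "E `` {v} = {u. (u, v) \<in> D}" using D'v by (auto simp: D_def)
  have B: "{} = {w. (v, w) \<in> D}" using vout by auto
  have "num_dependent D = num_dependent D' + (card (E `` {v}) - 1)"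
    using num_dependent_Diff_simplicial[OF finD acyc total_on_neighbours[OF DAO clique] res A B]
    by (metis add.right_neutral card.empty diff_0_eq_0)
  then show ?thesis using DAO by blast
qed

section \<open>The interval property by induction on the vertex set\<close>

lemma chordal_num_dependent_interval:
  fixes G :: "'a pair_pre_digraph"
  assumes G: "pair_graph G" and ch: "chordal G" and R: "finite R"
    and "l \<in> num_dependent ` acyclic_orients (parcs G \<inter> R \<times> R)"
    and "h \<in> num_dependent ` acyclic_orients (parcs G \<inter> R \<times> R)"
    and "l \<le> d" "d \<le> h"
  shows "d \<in> num_dependent ` acyclic_orients (parcs G \<inter> R \<times> R)"
  using R assms(4-)
proof (induction R arbitrary: l h d rule: finite_psubset_induct)
  case (psubset R)
  interpret pair_graph G by fact
  have symG: "(v, u) \<in> parcs G" if "(u, v) \<in> parcs G" for u v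
    using pair_sym_arcs that by (auto simp: symmetric_def dest: symD)
  have irr: "(u, u) \<notin> parcs G" for u using pair_no_loops[of "(u, u)"] by auto
  show ?case
  proof (cases "R = {}")
    case True
    then have "acyclic_orients (parcs G \<inter> R \<times> R) \<subseteq> {{}}" by (auto simp: acyclic_orients_def)
    then have "h = l" using psubset.prems by blast
    then show ?thesis using psubset.prems by auto
  next
    case False
    then obtain v where v: "v \<in> R"
      "\<forall>a\<in>R. \<forall>b\<in>R. (v, a) \<in> parcs G \<and> (v, b) \<in> parcs G \<and> a \<noteq> b \<longrightarrow> (a, b) \<in> parcs G"
      using chordal_ex_simplicial[OF G ch psubset.hyps False] by metis
    define E where "E = parcs G \<inter> R \<times> R"
    define c where "c = card (E `` {v}) - 1"
    have clique: "total_on (E `` {v}) E"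
      using v(2) by (auto simp: E_def total_on_def)
    have finE: "finite E" unfolding E_def using psubset.hyps by blast
    have symE: "sym E" unfolding E_def using symG by (auto intro: symI)
    have irrE: "(v, v) \<notin> E" using irr by (simp add: E_def)
    have E': "E \<inter> (- {v}) \<times> (- {v}) = parcs G \<inter> (R - {v}) \<times> (R - {v})"
      by (auto simp: E_def)
    let ?S' = "num_dependent ` acyclic_orients (parcs G \<inter> (R - {v}) \<times> (R - {v}))"
    have restr: "\<exists>s\<in>?S'. n \<le> s + c \<and> s + c \<le> Suc n"
      if n: "n \<in> num_dependent ` acyclic_orients E" for n
    proof -
      obtain D where D: "D \<in> acyclic_orients E" "n = num_dependent D" using n by auto
      let ?D' = "D \<inter> (- {v}) \<times> (- {v})"
      have "num_dependent ?D' \<in> ?S'"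
        using acyclic_orients_Diff_vertex[OF D(1), of v] unfolding E' by (rule imageI)
      then show ?thesis
        using num_dependent_Diff_simplicial_bounds[OF D(1) finE clique refl] D(2)
        unfolding c_def by (intro bexI[of _ "num_dependent ?D'"]) auto
    qed
    have extend: "s + c \<in> num_dependent ` acyclic_orients E" if s: "s \<in> ?S'" for s
    proof -
      obtain D' where D': "D' \<in> acyclic_orients (E \<inter> (- {v}) \<times> (- {v}))" "s = num_dependent D'"
        using s unfolding E' by auto
      obtain D where "D \<in> acyclic_orients E" "num_dependent D = s + c"
        using ex_extension_simplicial_sink[OF D'(1) finE symE irrE clique]
        unfolding c_def D'(2) by auto
      then show ?thesis by (metis imageI)
    qed
    obtain sl where sl: "sl \<in> ?S'" "sl + c \<le> Suc l"
      using restr psubset.prems(1) unfolding E_def by meson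
    obtain sh where sh: "sh \<in> ?S'" "h \<le> sh + c"
      using restr psubset.prems(2) unfolding E_def by meson
    show ?thesis
    proof (cases "d = l")
      case True
      then show ?thesis using psubset.prems by simp
    next
      \<comment> \<open>The restriction of an orientation with value \<open>l\<close> may have
        \<open>sl + c = l + 1\<close>, so only values \<open>d > l\<close> are guaranteed to be at
        least \<open>sl + c\<close>. This is why \<open>d = l\<close> is split off.\<close>
      case False
      then have d: "sl \<le> d - c" "d - c \<le> sh" "d = d - c + c"
        using sl(2) sh(2) psubset.prems(3,4) by linarith+
      have "R - {v} \<subset> R" using v(1) by auto
      then have "d - c \<in> ?S'" using psubset.IH sl(1) sh(1) d(1,2) by meson
      then show ?thesis using extend d(3) unfolding E_def by metis
    qed
  qed
qed

theorem theorem4: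
  fixes G :: "'a pair_pre_digraph"
  assumes "pair_graph G" and "chordal G"
  shows "fully_orientable G"
proof -
  interpret pair_graph G by fact
  let ?S = "num_dependent ` acyclic_orientations G"
  have "parcs G \<inter> pverts G \<times> pverts G = parcs G" using wellformed' by auto
  then have S: "?S = num_dependent ` acyclic_orients (parcs G \<inter> pverts G \<times> pverts G)"
    by (simp add: acyclic_orientations_eq_acyclic_orients)
  have fin: "finite ?S" "?S \<noteq> {}"
    using finite_acyclic_orientations acyclic_orientations_nonempty assms(1) by auto
  have "d \<in> ?S" if "d_min G \<le> d" "d \<le> d_max G" for d
    using chordal_num_dependent_interval[OF assms pair_finite_verts, folded S]
      Min_in[OF fin] Max_in[OF fin] that
    unfolding d_min_def d_max_def by blast
  then show ?thesis unfolding fully_orientable_def by (auto simp: image_iff)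
qed

end
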